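(* Let $T,T'$ be regular synctactical trees which differ only in one subtree, which is $S=(Qu/U)R$ in $T$ and $S'=(Qv/U)\,Subst(R,u,v)$ in $T'$. Suppose that $v$ does not occur in $S$ and $u\notin U$. Then $C(T)=C(T')$.
   Context: IF logic: formulas from (negated) atoms by $\land,\lor$ and slashed quantifiers $(\exists v/V),(\forall v/V)$, team semantics, $M\models\varphi$ iff $M,\{\emptyset\}\models\varphi$; $FV((Qv/V)\chi)=(FV(\chi)\setminus\{v\})\cup V$ (variables in slash sets count as occurrences). A synctactical tree is a finite tree of occurrences of atoms (leaves), negations and quantifiers (at most one successor), $\land,\lor$ (at most two successors); a subtree is the set of all nodes at or below a fixed node; $(Qu/U)R$ denotes a subtree whose root is $(Qu/U)$ followed by the tree $R$. $Subst(R,u,v)$ is $R$ with all free occurrences of $u$ replaced by $v$. Regular: no variable occurs both free and bound, and no $(Qv/V)$ lies in the scope of a same-kind $(Qv/W)$. $\hat T$: attach gap leaves (2 minus number of successors to each connective, one to each quantifier without successor); paths: maximal linear suborders of $\hat T$; $Bound(P)$: variables quantified in $P$. A completing function $e$ assigns a regular IF formula to each path; weak: quantifier-free; sentential: $FV(e(P))\subseteq Bound(P)$. $\hat e(T)$: place $e(P)$ at the gap of each path. $F_\varphi$: class of finite models of a sentence $\varphi$; $C(T)=\{F_{\hat e(T)}: e$ weak sentential completing function for $T\}$. *)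

theory Defs
  imports Main "HOL-Library.FSet" "HOL-Library.Sublist"
begin

section \<open>Independence-Friendly logic\<close>

type_synonym var = nat

record ('f, 'r) signature =
  fun_arity :: "'f \<rightharpoonup> nat"
  rel_arity :: "'r \<rightharpoonup> nat"

datatype 'f trm = Var var | Fun 'f "'f trm list"

datatype ('f, 'r) atom = Eq "'f trm" "'f trm" | Rel 'r "'f trm list"

datatype connective = Conj | Disj

datatype quantifier = Exists | Forall

text \<open>\<open>Quant q v V \<phi>\<close> stands for \<open>(qv/V)\<phi>\<close>, where \<open>V\<close> is the slash set.
  Negation occurs in front of atoms only.\<close>

datatype ('f, 'r) form =
    Atom "('f, 'r) atom"
  | NegAtom "('f, 'r) atom"
  | Conn connective "('f, 'r) form" "('f, 'r) form"
  | Quant quantifier var "var fset" "('f, 'r) form"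

fun vars_trm :: "'f trm \<Rightarrow> var set" where
  "vars_trm (Var x) = {x}"
| "vars_trm (Fun f ts) = (\<Union>t\<in>set ts. vars_trm t)"

primrec vars_atom :: "('f, 'r) atom \<Rightarrow> var set" where
  "vars_atom (Eq s t) = vars_trm s \<union> vars_trm t"
| "vars_atom (Rel r ts) = (\<Union>t\<in>set ts. vars_trm t)"

fun wf_trm :: "('f, 'r) signature \<Rightarrow> 'f trm \<Rightarrow> bool" where
  "wf_trm \<sigma> (Var x) \<longleftrightarrow> True"
| "wf_trm \<sigma> (Fun f ts) \<longleftrightarrow>
     fun_arity \<sigma> f = Some (length ts) \<and> (\<forall>t\<in>set ts. wf_trm \<sigma> t)"

primrec wf_atom :: "('f, 'r) signature \<Rightarrow> ('f, 'r) atom \<Rightarrow> bool" where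
  "wf_atom \<sigma> (Eq s t) \<longleftrightarrow> wf_trm \<sigma> s \<and> wf_trm \<sigma> t"
| "wf_atom \<sigma> (Rel r ts) \<longleftrightarrow> rel_arity \<sigma> r = Some (length ts) \<and> (\<forall>t\<in>set ts. wf_trm \<sigma> t)"

primrec wf_form :: "('f, 'r) signature \<Rightarrow> ('f, 'r) form \<Rightarrow> bool" where
  "wf_form \<sigma> (Atom a) \<longleftrightarrow> wf_atom \<sigma> a"
| "wf_form \<sigma> (NegAtom a) \<longleftrightarrow> wf_atom \<sigma> a"
| "wf_form \<sigma> (Conn c \<phi> \<psi>) \<longleftrightarrow> wf_form \<sigma> \<phi> \<and> wf_form \<sigma> \<psi>"
| "wf_form \<sigma> (Quant q v V \<phi>) \<longleftrightarrow> wf_form \<sigma> \<phi>"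

primrec FV :: "('f, 'r) form \<Rightarrow> var set" where
  "FV (Atom a) = vars_atom a"
| "FV (NegAtom a) = vars_atom a"
| "FV (Conn c \<phi> \<psi>) = FV \<phi> \<union> FV \<psi>"
| "FV (Quant q v V \<phi>) = (FV \<phi> - {v}) \<union> fset V"

primrec BV :: "('f, 'r) form \<Rightarrow> var set" where
  "BV (Atom a) = {}"
| "BV (NegAtom a) = {}"
| "BV (Conn c \<phi> \<psi>) = BV \<phi> \<union> BV \<psi>"
| "BV (Quant q v V \<phi>) = insert v (BV \<phi>)"

primrec no_requantification :: "('f, 'r) form \<Rightarrow> bool" where
  "no_requantification (Atom a) \<longleftrightarrow> True"
| "no_requantification (NegAtom a) \<longleftrightarrow> True"
| "no_requantification (Conn c \<phi> \<psi>) \<longleftrightarrow> no_requantification \<phi> \<and> no_requantification \<psi>"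
| "no_requantification (Quant q v V \<phi>) \<longleftrightarrow> v \<notin> BV \<phi> \<and> no_requantification \<phi>"

definition regular_form :: "('f, 'r) form \<Rightarrow> bool" where
  "regular_form \<phi> \<longleftrightarrow> FV \<phi> \<inter> BV \<phi> = {} \<and> no_requantification \<phi>"

primrec quantifier_free :: "('f, 'r) form \<Rightarrow> bool" where
  "quantifier_free (Atom a) \<longleftrightarrow> True"
| "quantifier_free (NegAtom a) \<longleftrightarrow> True"
| "quantifier_free (Conn c \<phi> \<psi>) \<longleftrightarrow> quantifier_free \<phi> \<and> quantifier_free \<psi>"
| "quantifier_free (Quant q v V \<phi>) \<longleftrightarrow> False"

definition sentence :: "('f, 'r) signature \<Rightarrow> ('f, 'r) form \<Rightarrow> bool" where
  "sentence \<sigma> \<phi> \<longleftrightarrow> wf_form \<sigma> \<phi> \<and> FV \<phi> = {}"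


subsection \<open>Team semantics\<close>

record ('a, 'f, 'r) struct =
  universe :: "'a set"
  fun_interp :: "'f \<Rightarrow> 'a list \<Rightarrow> 'a"
  rel_interp :: "'r \<Rightarrow> 'a list set"

definition is_structure :: "('f, 'r) signature \<Rightarrow> ('a, 'f, 'r) struct \<Rightarrow> bool" where
  "is_structure \<sigma> M \<longleftrightarrow>
     universe M \<noteq> {} \<and>
     (\<forall>f n as. fun_arity \<sigma> f = Some n \<longrightarrow> length as = n \<longrightarrow> set as \<subseteq> universe M \<longrightarrow>
        fun_interp M f as \<in> universe M) \<and>
     (\<forall>r n. rel_arity \<sigma> r = Some n \<longrightarrow>
        rel_interp M r \<subseteq> {as. length as = n \<and> set as \<subseteq> universe M})"

text \<open>Assignments are partial functions; a team is a set of assignments with a common domain.\<close>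

type_synonym 'a assignment = "var \<rightharpoonup> 'a"
type_synonym 'a team = "'a assignment set"

primrec eval_trm :: "('a, 'f, 'r) struct \<Rightarrow> 'a assignment \<Rightarrow> 'f trm \<Rightarrow> 'a" where
  "eval_trm M s (Var x) = the (s x)"
| "eval_trm M s (Fun f ts) = fun_interp M f (map (eval_trm M s) ts)"

primrec sat_atom :: "('a, 'f, 'r) struct \<Rightarrow> 'a assignment \<Rightarrow> ('f, 'r) atom \<Rightarrow> bool" where
  "sat_atom M s (Eq t t') \<longleftrightarrow> eval_trm M s t = eval_trm M s t'"
| "sat_atom M s (Rel r ts) \<longleftrightarrow> map (eval_trm M s) ts \<in> rel_interp M r"

definition uniform :: "var fset \<Rightarrow> 'a team \<Rightarrow> ('a assignment \<Rightarrow> 'a) \<Rightarrow> bool" where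
  "uniform V X F \<longleftrightarrow>
     (\<forall>s\<in>X. \<forall>s'\<in>X. (\<forall>x. x |\<notin>| V \<longrightarrow> s x = s' x) \<longrightarrow> F s = F s')"

definition supplement :: "'a team \<Rightarrow> var \<Rightarrow> ('a assignment \<Rightarrow> 'a) \<Rightarrow> 'a team" where
  "supplement X v F = {s(v \<mapsto> F s) | s. s \<in> X}"

definition duplicate :: "'a team \<Rightarrow> var \<Rightarrow> 'a set \<Rightarrow> 'a team" where
  "duplicate X v A = {s(v \<mapsto> a) | s a. s \<in> X \<and> a \<in> A}"

fun sat :: "('a, 'f, 'r) struct \<Rightarrow> 'a team \<Rightarrow> ('f, 'r) form \<Rightarrow> bool" where
  "sat M X (Atom a) \<longleftrightarrow> (\<forall>s\<in>X. sat_atom M s a)"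
| "sat M X (NegAtom a) \<longleftrightarrow> (\<forall>s\<in>X. \<not> sat_atom M s a)"
| "sat M X (Conn Conj \<phi> \<psi>) \<longleftrightarrow> sat M X \<phi> \<and> sat M X \<psi>"
| "sat M X (Conn Disj \<phi> \<psi>) \<longleftrightarrow> (\<exists>Y Z. X = Y \<union> Z \<and> sat M Y \<phi> \<and> sat M Z \<psi>)"
| "sat M X (Quant Exists v V \<phi>) \<longleftrightarrow>
     (\<exists>F. F ` X \<subseteq> universe M \<and> uniform V X F \<and> sat M (supplement X v F) \<phi>)"
| "sat M X (Quant Forall v V \<phi>) \<longleftrightarrow> sat M (duplicate X v (universe M)) \<phi>"

definition true_in :: "('a, 'f, 'r) struct \<Rightarrow> ('f, 'r) form \<Rightarrow> bool" where
  "true_in M \<phi> \<longleftrightarrow> sat M {Map.empty} \<phi>"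

definition finite_models ::
  "('f, 'r) signature \<Rightarrow> ('f, 'r) form \<Rightarrow> ('a, 'f, 'r) struct set" where
  "finite_models \<sigma> \<phi> = {M. is_structure \<sigma> M \<and> finite (universe M) \<and> true_in M \<phi>}"


section \<open>Syntactical trees\<close>

text \<open>\<open>None\<close> marks a missing successor.\<close>

datatype ('f, 'r) tree =
    TAtom "('f, 'r) atom"
  | TNeg "('f, 'r) tree option"
  | TConn connective "('f, 'r) tree option" "('f, 'r) tree option"
  | TQuant quantifier var "var fset" "('f, 'r) tree option"

fun tree_FV :: "('f, 'r) tree \<Rightarrow> var set" where
  "tree_FV (TAtom a) = vars_atom a"
| "tree_FV (TNeg t) = (\<Union>t'\<in>set_option t. tree_FV t')"
| "tree_FV (TConn c l r) = (\<Union>t'\<in>set_option l. tree_FV t') \<union> (\<Union>t'\<in>set_option r. tree_FV t')"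
| "tree_FV (TQuant q v V t) = ((\<Union>t'\<in>set_option t. tree_FV t') - {v}) \<union> fset V"

fun tree_BV :: "('f, 'r) tree \<Rightarrow> var set" where
  "tree_BV (TAtom a) = {}"
| "tree_BV (TNeg t) = (\<Union>t'\<in>set_option t. tree_BV t')"
| "tree_BV (TConn c l r) = (\<Union>t'\<in>set_option l. tree_BV t') \<union> (\<Union>t'\<in>set_option r. tree_BV t')"
| "tree_BV (TQuant q v V t) = insert v (\<Union>t'\<in>set_option t. tree_BV t')"

text \<open>All occurrences count: in atoms, in slash sets and immediately after a quantifier.\<close>

fun tree_vars :: "('f, 'r) tree \<Rightarrow> var set" where
  "tree_vars (TAtom a) = vars_atom a"
| "tree_vars (TNeg t) = (\<Union>t'\<in>set_option t. tree_vars t')"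
| "tree_vars (TConn c l r) =
     (\<Union>t'\<in>set_option l. tree_vars t') \<union> (\<Union>t'\<in>set_option r. tree_vars t')"
| "tree_vars (TQuant q v V t) = insert v (\<Union>t'\<in>set_option t. tree_vars t') \<union> fset V"

fun tree_no_requantification :: "('f, 'r) tree \<Rightarrow> bool" where
  "tree_no_requantification (TAtom a) \<longleftrightarrow> True"
| "tree_no_requantification (TNeg t) \<longleftrightarrow> (\<forall>t'\<in>set_option t. tree_no_requantification t')"
| "tree_no_requantification (TConn c l r) \<longleftrightarrow>
     (\<forall>t'\<in>set_option l. tree_no_requantification t') \<and>
     (\<forall>t'\<in>set_option r. tree_no_requantification t')"
| "tree_no_requantification (TQuant q v V t) \<longleftrightarrow>
     (\<forall>t'\<in>set_option t. v \<notin> tree_BV t' \<and> tree_no_requantification t')"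

definition regular_tree :: "('f, 'r) tree \<Rightarrow> bool" where
  "regular_tree T \<longleftrightarrow> tree_FV T \<inter> tree_BV T = {} \<and> tree_no_requantification T"

definition rename_var :: "var \<Rightarrow> var \<Rightarrow> var \<Rightarrow> var" where
  "rename_var u v x = (if x = u then v else x)"

primrec subst_trm :: "'f trm \<Rightarrow> var \<Rightarrow> var \<Rightarrow> 'f trm" where
  "subst_trm (Var x) u v = Var (rename_var u v x)"
| "subst_trm (Fun f ts) u v = Fun f (map (\<lambda>t. subst_trm t u v) ts)"

primrec subst_atom :: "('f, 'r) atom \<Rightarrow> var \<Rightarrow> var \<Rightarrow> ('f, 'r) atom" where
  "subst_atom (Eq s t) u v = Eq (subst_trm s u v) (subst_trm t u v)"
| "subst_atom (Rel r ts) u v = Rel r (map (\<lambda>t. subst_trm t u v) ts)"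

text \<open>Elements of the slash set of a quantifier are free occurrences, even of the variable
  which that quantifier binds; hence the slash set is always renamed.\<close>

fun Subst :: "('f, 'r) tree \<Rightarrow> var \<Rightarrow> var \<Rightarrow> ('f, 'r) tree" where
  "Subst (TAtom a) u v = TAtom (subst_atom a u v)"
| "Subst (TNeg t) u v = TNeg (map_option (\<lambda>t'. Subst t' u v) t)"
| "Subst (TConn c l r) u v =
     TConn c (map_option (\<lambda>t'. Subst t' u v) l) (map_option (\<lambda>t'. Subst t' u v) r)"
| "Subst (TQuant q w W t) u v =
     TQuant q w (rename_var u v |`| W)
       (if w = u then t else map_option (\<lambda>t'. Subst t' u v) t)"

text \<open>\<open>differ_in_subtree S S' T T'\<close>: \<open>T'\<close> arises from \<open>T\<close> by replacing the subtree \<open>S\<close>,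
  rooted at one particular node of \<open>T\<close>, by \<open>S'\<close>.\<close>

inductive differ_in_subtree ::
  "('f, 'r) tree \<Rightarrow> ('f, 'r) tree \<Rightarrow> ('f, 'r) tree \<Rightarrow> ('f, 'r) tree \<Rightarrow> bool"
  for S S' where
  root: "differ_in_subtree S S' S S'"
| neg: "differ_in_subtree S S' t t' \<Longrightarrow> differ_in_subtree S S' (TNeg (Some t)) (TNeg (Some t'))"
| left: "differ_in_subtree S S' t t' \<Longrightarrow>
    differ_in_subtree S S' (TConn c (Some t) r) (TConn c (Some t') r)"
| right: "differ_in_subtree S S' t t' \<Longrightarrow>
    differ_in_subtree S S' (TConn c l (Some t)) (TConn c l (Some t'))"
| quant: "differ_in_subtree S S' t t' \<Longrightarrow>
    differ_in_subtree S S' (TQuant q w W (Some t)) (TQuant q w W (Some t'))"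


subsection \<open>Gaps, paths and completing functions\<close>

text \<open>The tree \<open>hat T\<close> has the gaps as additional leaves. A negation without successor gets no gap.\<close>

datatype ('f, 'r) gap_tree =
    Gap
  | GAtom "('f, 'r) atom"
  | GNeg "('f, 'r) gap_tree option"
  | GConn connective "('f, 'r) gap_tree" "('f, 'r) gap_tree"
  | GQuant quantifier var "var fset" "('f, 'r) gap_tree"

fun hat :: "('f, 'r) tree \<Rightarrow> ('f, 'r) gap_tree" where
  "hat (TAtom a) = GAtom a"
| "hat (TNeg t) = GNeg (map_option hat t)"
| "hat (TConn c l r) =
     GConn c (case l of None \<Rightarrow> Gap | Some t \<Rightarrow> hat t) (case r of None \<Rightarrow> Gap | Some t \<Rightarrow> hat t)"
| "hat (TQuant q v V t) = GQuant q v V (case t of None \<Rightarrow> Gap | Some t' \<Rightarrow> hat t')"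

text \<open>A node is identified with its position, the list of branchings leading to it from the root.
  The tree order is then the prefix order on positions.\<close>

type_synonym position = "nat list"

fun subtree_at :: "('f, 'r) gap_tree \<Rightarrow> position \<Rightarrow> ('f, 'r) gap_tree option" where
  "subtree_at G [] = Some G"
| "subtree_at (GNeg (Some G)) (0 # p) = subtree_at G p"
| "subtree_at (GConn c G H) (0 # p) = subtree_at G p"
| "subtree_at (GConn c G H) (Suc 0 # p) = subtree_at H p"
| "subtree_at (GQuant q v V G) (0 # p) = subtree_at G p"
| "subtree_at G (i # p) = None"

definition nodes :: "('f, 'r) gap_tree \<Rightarrow> position set" where
  "nodes G = {p. subtree_at G p \<noteq> None}"

definition paths :: "('f, 'r) tree \<Rightarrow> position set set" where
  "paths T = {P. pred_on.maxchain (nodes (hat T)) prefix P}"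

definition Bound :: "('f, 'r) tree \<Rightarrow> position set \<Rightarrow> var set" where
  "Bound T P = {v. \<exists>p\<in>P. \<exists>q V G. subtree_at (hat T) p = Some (GQuant q v V G)}"

type_synonym ('f, 'r) completing = "position set \<Rightarrow> ('f, 'r) form"

definition completing_function ::
  "('f, 'r) signature \<Rightarrow> ('f, 'r) tree \<Rightarrow> ('f, 'r) completing \<Rightarrow> bool" where
  "completing_function \<sigma> T e \<longleftrightarrow> (\<forall>P\<in>paths T. wf_form \<sigma> (e P) \<and> regular_form (e P))"

definition weak :: "('f, 'r) tree \<Rightarrow> ('f, 'r) completing \<Rightarrow> bool" where
  "weak T e \<longleftrightarrow> (\<forall>P\<in>paths T. quantifier_free (e P))"

definition sentential :: "('f, 'r) tree \<Rightarrow> ('f, 'r) completing \<Rightarrow> bool" where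
  "sentential T e \<longleftrightarrow> (\<forall>P\<in>paths T. FV (e P) \<subseteq> Bound T P)"

text \<open>\<open>fill e p G\<close> fills the gaps of \<open>G\<close>, where \<open>G\<close> is the subtree at position \<open>p\<close> of the whole
  tree; the path through a gap consists of the prefixes of the position of that gap. The result
  is \<open>None\<close> if it is not a formula because some negation is not followed by an atom.\<close>

fun fill :: "('f, 'r) completing \<Rightarrow> position \<Rightarrow> ('f, 'r) gap_tree \<Rightarrow> ('f, 'r) form option" where
  "fill e p Gap = Some (e (set (prefixes p)))"
| "fill e p (GAtom a) = Some (Atom a)"
| "fill e p (GNeg (Some (GAtom a))) = Some (NegAtom a)"
| "fill e p (GNeg _) = None"
| "fill e p (GConn c G H) =
     (case (fill e (p @ [0]) G, fill e (p @ [1]) H) of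
        (Some \<phi>, Some \<psi>) \<Rightarrow> Some (Conn c \<phi> \<psi>)
      | _ \<Rightarrow> None)"
| "fill e p (GQuant q v V G) = map_option (Quant q v V) (fill e (p @ [0]) G)"

definition completion :: "('f, 'r) completing \<Rightarrow> ('f, 'r) tree \<Rightarrow> ('f, 'r) form option" where
  "completion e T = fill e [] (hat T)"

text \<open>The class of finite models is defined for sentences only, so completions which are not
  sentences (for instance because \<open>T\<close> itself has free variables) do not contribute.\<close>

definition C :: "('f, 'r) signature \<Rightarrow> ('f, 'r) tree \<Rightarrow> ('a, 'f, 'r) struct set set" where
  "C \<sigma> T = {finite_models \<sigma> \<phi> | \<phi> e.
     completing_function \<sigma> T e \<and> weak T e \<and> sentential T e \<and>
     completion e T = Some \<phi> \<and> sentence \<sigma> \<phi>}"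

end

theory Submission
  imports Defs "HOL-Combinatorics.Transposition"
begin

text \<open>Let \<open>\<pi>\<close> be the transposition of \<open>u\<close> and \<open>v\<close>. Under the hypotheses \<open>S'\<close> is \<open>S\<close> with all
  variables, free or bound, renamed by \<open>\<pi>\<close>, and regularity of \<open>T\<close> and \<open>T'\<close> shows that no
  quantifier above \<open>S\<close> binds \<open>u\<close> or \<open>v\<close>. Team semantics is invariant under permutations of the
  variables, and the teams arriving at \<open>S\<close> are undefined on \<open>u\<close> and \<open>v\<close>, hence fixed by \<open>\<pi>\<close>.
  So applying \<open>\<pi>\<close> to the values of a completing function on the paths through \<open>S\<close> gives a
  completing function for \<open>T'\<close> which defines the same class; the situation is symmetric.\<close>

section \<open>Permuting the variables of a formula\<close>

primrec rename_trm :: "(var \<Rightarrow> var) \<Rightarrow> 'f trm \<Rightarrow> 'f trm" where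
  "rename_trm \<pi> (Var x) = Var (\<pi> x)"
| "rename_trm \<pi> (Fun f ts) = Fun f (map (rename_trm \<pi>) ts)"

primrec rename_atom :: "(var \<Rightarrow> var) \<Rightarrow> ('f, 'r) atom \<Rightarrow> ('f, 'r) atom" where
  "rename_atom \<pi> (Eq s t) = Eq (rename_trm \<pi> s) (rename_trm \<pi> t)"
| "rename_atom \<pi> (Rel r ts) = Rel r (map (rename_trm \<pi>) ts)"

primrec rename_form :: "(var \<Rightarrow> var) \<Rightarrow> ('f, 'r) form \<Rightarrow> ('f, 'r) form" where
  "rename_form \<pi> (Atom a) = Atom (rename_atom \<pi> a)"
| "rename_form \<pi> (NegAtom a) = NegAtom (rename_atom \<pi> a)"
| "rename_form \<pi> (Conn c \<phi> \<psi>) = Conn c (rename_form \<pi> \<phi>) (rename_form \<pi> \<psi>)"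
| "rename_form \<pi> (Quant q v V \<phi>) = Quant q (\<pi> v) (\<pi> |`| V) (rename_form \<pi> \<phi>)"

lemma vars_rename_trm: "vars_trm (rename_trm \<pi> t) = \<pi> ` vars_trm t"
  by (induction t) auto

lemma vars_rename_atom: "vars_atom (rename_atom \<pi> a) = \<pi> ` vars_atom a"
  by (cases a) (auto simp: vars_rename_trm)

lemma wf_rename_trm: "wf_trm \<sigma> (rename_trm \<pi> t) \<longleftrightarrow> wf_trm \<sigma> t"
  by (induction t) auto

lemma wf_rename_form: "wf_form \<sigma> (rename_form \<pi> \<phi>) \<longleftrightarrow> wf_form \<sigma> \<phi>"
proof -
  have "wf_atom \<sigma> (rename_atom \<pi> a) \<longleftrightarrow> wf_atom \<sigma> a" for a :: "('a, 'b) atom"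
    by (cases a) (auto simp: wf_rename_trm)
  then show ?thesis
    by (induction \<phi>) auto
qed

lemma quantifier_free_rename_form: "quantifier_free (rename_form \<pi> \<phi>) \<longleftrightarrow> quantifier_free \<phi>"
  by (induction \<phi>) auto

lemma FV_rename_form:
  assumes "inj \<pi>"
  shows "FV (rename_form \<pi> \<phi>) = \<pi> ` FV \<phi>"
  by (induction \<phi>) (auto simp: vars_rename_atom inj_eq[OF assms])

lemma BV_rename_form: "BV (rename_form \<pi> \<phi>) = \<pi> ` BV \<phi>"
  by (induction \<phi>) auto

lemma regular_rename_form:
  assumes "inj \<pi>"
  shows "regular_form (rename_form \<pi> \<phi>) \<longleftrightarrow> regular_form \<phi>"
proof -
  have "no_requantification (rename_form \<pi> \<phi>) \<longleftrightarrow> no_requantification \<phi>"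
    by (induction \<phi>) (auto simp: BV_rename_form inj_image_mem_iff[OF assms])
  then show ?thesis
    by (simp add: regular_form_def FV_rename_form[OF assms] BV_rename_form
        image_Int[OF assms, symmetric])
qed

lemma rename_trm_involution:
  assumes "\<And>x. \<pi> (\<pi> x) = x"
  shows "rename_trm \<pi> (rename_trm \<pi> t) = t"
  by (induction t) (auto simp: assms intro: map_idI)

lemma rename_atom_involution:
  assumes "\<And>x. \<pi> (\<pi> x) = x"
  shows "rename_atom \<pi> (rename_atom \<pi> a) = a"
  by (cases a) (auto simp: rename_trm_involution[OF assms] intro: map_idI)

lemma fimage_involution:
  assumes "\<And>x. \<pi> (\<pi> x) = x"
  shows "\<pi> |`| \<pi> |`| V = V"
  by (simp add: fset.map_comp comp_def assms)

lemma rename_form_involution: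
  assumes "\<And>x. \<pi> (\<pi> x) = x"
  shows "rename_form \<pi> (rename_form \<pi> \<phi>) = \<phi>"
  by (induction \<phi>) (auto simp: rename_atom_involution[OF assms] fimage_involution[OF assms] assms)

lemma inj_involution:
  assumes "\<And>x. \<pi> (\<pi> x) = x"
  shows "inj \<pi>"
  by (metis assms injI)


subsection \<open>Invariance of team semantics\<close>

text \<open>Renaming variables along \<open>\<pi>\<close> acts on assignments by composition with
  the inverse of \<open>\<pi>\<close>. Only involutions are used here, so \<open>\<pi>\<close>
  itself can be composed.\<close>

abbreviation rename_team :: "(var \<Rightarrow> var) \<Rightarrow> 'a team \<Rightarrow> 'a team" where
  "rename_team \<pi> X \<equiv> (\<lambda>s. s \<circ> \<pi>) ` X"

lemma rename_team_involution:
  assumes "\<And>x. \<pi> (\<pi> x) = x"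
  shows "rename_team \<pi> (rename_team \<pi> X) = X"
  by (simp add: image_image comp_def assms)

lemma upd_comp_involution:
  assumes "\<And>x. \<pi> (\<pi> x) = x"
  shows "(s(v \<mapsto> a)) \<circ> \<pi> = (s \<circ> \<pi>)(\<pi> v \<mapsto> a)"
  using assms by (auto simp: fun_eq_iff)

lemma sat_rename_atom:
  assumes "\<And>x. \<pi> (\<pi> x) = x"
  shows "sat_atom M (s \<circ> \<pi>) (rename_atom \<pi> a) \<longleftrightarrow> sat_atom M s a"
proof -
  have "eval_trm M (s \<circ> \<pi>) (rename_trm \<pi> t) = eval_trm M s t" for t
    by (induction t) (simp_all add: assms comp_def cong: map_cong)
  then show ?thesis
    by (cases a) (simp_all add: comp_def)
qed

text \<open>One implication is enough: renaming once more undoes the renaming and yields the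
  converse in \<open>sat_rename_form\<close>. The case with content is the existential one, where a
  uniform choice function must be transported.\<close>

lemma sat_rename_form_imp:
  assumes inv: "\<And>x. \<pi> (\<pi> x) = x"
  shows "sat M X \<phi> \<Longrightarrow> sat M (rename_team \<pi> X) (rename_form \<pi> \<phi>)"
proof (induction M X \<phi> rule: sat.induct)
  case (4 M X \<phi> \<psi>)
  then show ?case by (simp add: image_Un) (metis image_Un)
next
  case (5 M X v V \<phi>)
  then obtain F where F: "F ` X \<subseteq> universe M" "uniform V X F"
    "sat M (supplement X v F) \<phi>"
    by auto
  from 5(1)[OF F(3)] have IH: "sat M (rename_team \<pi> (supplement X v F)) (rename_form \<pi> \<phi>)" .
  let ?F = "\<lambda>s. F (s \<circ> \<pi>)"
  have inv': "s \<circ> \<pi> \<circ> \<pi> = s" for s :: "'a assignment"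
    by (simp add: fun_eq_iff inv)
  have "?F ` rename_team \<pi> X \<subseteq> universe M"
    using F(1) by (auto simp: inv')
  moreover have "uniform (\<pi> |`| V) (rename_team \<pi> X) ?F"
    unfolding uniform_def
  proof (intro ballI impI)
    fix s s'
    assume s: "s \<in> rename_team \<pi> X" "s' \<in> rename_team \<pi> X"
      and eq: "\<forall>x. x |\<notin>| \<pi> |`| V \<longrightarrow> s x = s' x"
    have "s \<circ> \<pi> \<in> X" "s' \<circ> \<pi> \<in> X"
      using s by (auto simp: inv')
    moreover have "(s \<circ> \<pi>) x = (s' \<circ> \<pi>) x" if "x |\<notin>| V" for x
      using eq that by (metis comp_apply fimageE inv)
    ultimately show "F (s \<circ> \<pi>) = F (s' \<circ> \<pi>)"
      using F(2) unfolding uniform_def by blast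
  qed
  moreover have "supplement (rename_team \<pi> X) (\<pi> v) ?F = rename_team \<pi> (supplement X v F)"
    by (simp add: supplement_def Setcompr_eq_image image_image upd_comp_involution[OF inv] inv')
  ultimately have "sat M (rename_team \<pi> X) (Quant Exists (\<pi> v) (\<pi> |`| V) (rename_form \<pi> \<phi>))"
    unfolding sat.simps using IH by (intro exI[of _ ?F]) presburger
  then show ?case by (simp only: rename_form.simps)
next
  case (6 M X v V \<phi>)
  have dup: "duplicate Y w A = (\<Union>s\<in>Y. (\<lambda>a. s(w \<mapsto> a)) ` A)" for Y :: "'a team" and w A
    by (auto simp: duplicate_def)
  have "duplicate (rename_team \<pi> X) (\<pi> v) (universe M) = rename_team \<pi> (duplicate X v (universe M))"
    by (simp add: dup image_UN image_image upd_comp_involution[OF inv])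
  moreover have "sat M (rename_team \<pi> (duplicate X v (universe M))) (rename_form \<pi> \<phi>)"
    using 6 by (simp only: sat.simps)
  ultimately show ?case by (simp only: rename_form.simps sat.simps)
qed (auto simp: sat_rename_atom[OF inv])

lemma sat_rename_form:
  assumes "\<And>x. \<pi> (\<pi> x) = x"
  shows "sat M (rename_team \<pi> X) (rename_form \<pi> \<phi>) \<longleftrightarrow> sat M X \<phi>"
  using sat_rename_form_imp[OF assms, where X = X and \<phi> = \<phi>]
    sat_rename_form_imp[OF assms, where X = "rename_team \<pi> X" and \<phi> = "rename_form \<pi> \<phi>"]
  unfolding rename_form_involution[OF assms] rename_team_involution[OF assms] by blast

text \<open>If \<open>\<pi>\<close> moves \<open>x\<close>, it also moves \<open>\<pi> x\<close>, by
  involution. So both lie outside the domain of \<open>s\<close>, and \<open>s\<close> is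
  \<open>None\<close> at both.\<close>

lemma rename_team_fixed:
  assumes inv: "\<And>x. \<pi> (\<pi> x) = x"
    and fixed: "\<forall>s\<in>X. \<forall>x\<in>dom s. \<pi> x = x"
  shows "rename_team \<pi> X = X"
proof -
  have "s \<circ> \<pi> = s" if "s \<in> X" for s
  proof
    fix x
    show "(s \<circ> \<pi>) x = s x"
      using fixed that inv by (cases "\<pi> x = x") (simp, metis comp_apply domIff)
  qed
  then show ?thesis by simp
qed


section \<open>Renaming a subformula\<close>

text \<open>The condition \<open>\<pi> w = w\<close> on the quantifiers above the renamed part keeps
  moved variables out of the domains of the teams that reach it. Slash sets above the part stay as
  they are.\<close>

inductive renamed_part :: "(var \<Rightarrow> var) \<Rightarrow> ('f, 'r) form \<Rightarrow> ('f, 'r) form \<Rightarrow> bool" for \<pi> where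
  whole: "renamed_part \<pi> \<phi> (rename_form \<pi> \<phi>)"
| left: "renamed_part \<pi> \<phi> \<phi>' \<Longrightarrow> renamed_part \<pi> (Conn c \<phi> \<psi>) (Conn c \<phi>' \<psi>)"
| right: "renamed_part \<pi> \<psi> \<psi>' \<Longrightarrow> renamed_part \<pi> (Conn c \<phi> \<psi>) (Conn c \<phi> \<psi>')"
| quant: "renamed_part \<pi> \<phi> \<phi>' \<Longrightarrow> \<pi> w = w \<Longrightarrow> renamed_part \<pi> (Quant q w W \<phi>) (Quant q w W \<phi>')"

lemma renamed_part_wf: "renamed_part \<pi> \<phi> \<phi>' \<Longrightarrow> wf_form \<sigma> \<phi>' \<longleftrightarrow> wf_form \<sigma> \<phi>"
  by (induction rule: renamed_part.induct) (auto simp: wf_rename_form)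

text \<open>The hypothesis on free variables passes below a quantifier: its body can gain only the
  bound variable, which \<open>\<pi>\<close> fixes.\<close>

lemma renamed_part_FV:
  assumes "renamed_part \<pi> \<phi> \<phi>'" and "inj \<pi>" and "\<forall>x\<in>FV \<phi>. \<pi> x = x"
  shows "FV \<phi>' = FV \<phi>"
  using assms(1,3)
proof (induction rule: renamed_part.induct)
  case (whole \<phi>)
  then show ?case by (simp add: FV_rename_form[OF assms(2)])
next
  case (quant \<phi> \<phi>' w q W)
  then have "FV \<phi>' = FV \<phi>" by (auto split: if_splits)
  then show ?case by simp
qed auto

text \<open>The domain condition is inherited by subteams, and by supplemented and duplicated teams
  because \<open>w\<close> is fixed. At the renamed part the team equals its own renaming, so
  invariance applies.\<close>

lemma renamed_part_sat:
  assumes "renamed_part \<pi> \<phi> \<phi>'"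
    and inv: "\<And>x. \<pi> (\<pi> x) = x"
    and "\<forall>s\<in>X. \<forall>x\<in>dom s. \<pi> x = x"
  shows "sat M X \<phi>' \<longleftrightarrow> sat M X \<phi>"
  using assms(1,3)
proof (induction arbitrary: X rule: renamed_part.induct)
  case (whole \<phi>)
  then show ?case
    using sat_rename_form[OF inv, of M X \<phi>] rename_team_fixed[OF inv, of X] by simp
next
  case (left \<phi> \<phi>' c \<psi>)
  show ?case
  proof (cases c)
    case Conj
    then show ?thesis using left by simp
  next
    case Disj
    have "sat M Y \<phi>' \<longleftrightarrow> sat M Y \<phi>" if "Y \<subseteq> X" for Y
      using left.IH left.prems that by (meson subsetD)
    then show ?thesis using Disj by auto
  qed
next
  case (right \<psi> \<psi>' c \<phi>)
  show ?case
  proof (cases c)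
    case Conj
    then show ?thesis using right by simp
  next
    case Disj
    have "sat M Y \<psi>' \<longleftrightarrow> sat M Y \<psi>" if "Y \<subseteq> X" for Y
      using right.IH right.prems that by (meson subsetD)
    then show ?thesis using Disj by auto
  qed
next
  case (quant \<phi> \<phi>' w q W)
  have upd: "\<forall>x\<in>dom (s(w \<mapsto> a)). \<pi> x = x" if "s \<in> X" for s a
    using quant.prems[rule_format, OF that] quant.hyps(2) by simp
  show ?case
  proof (cases q)
    case Exists
    have "sat M (supplement X w F) \<phi>' \<longleftrightarrow> sat M (supplement X w F) \<phi>" for F
      by (rule quant.IH) (use upd in \<open>unfold supplement_def, blast\<close>)
    then show ?thesis using Exists by simp
  next
    case Forall
    have "sat M (duplicate X w (universe M)) \<phi>' \<longleftrightarrow> sat M (duplicate X w (universe M)) \<phi>"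
      by (rule quant.IH) (use upd in \<open>unfold duplicate_def, blast\<close>)
    then show ?thesis using Forall by simp
  qed
qed


section \<open>Renaming a subtree\<close>

fun rename_gap_tree :: "(var \<Rightarrow> var) \<Rightarrow> ('f, 'r) gap_tree \<Rightarrow> ('f, 'r) gap_tree" where
  "rename_gap_tree \<pi> Gap = Gap"
| "rename_gap_tree \<pi> (GAtom a) = GAtom (rename_atom \<pi> a)"
| "rename_gap_tree \<pi> (GNeg G) = GNeg (map_option (rename_gap_tree \<pi>) G)"
| "rename_gap_tree \<pi> (GConn c G H) = GConn c (rename_gap_tree \<pi> G) (rename_gap_tree \<pi> H)"
| "rename_gap_tree \<pi> (GQuant q w W G) = GQuant q (\<pi> w) (\<pi> |`| W) (rename_gap_tree \<pi> G)"

lemma rename_gap_tree_involution: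
  assumes "\<And>x. \<pi> (\<pi> x) = x"
  shows "rename_gap_tree \<pi> (rename_gap_tree \<pi> G) = G"
proof (induction G)
  case (GNeg G)
  then show ?case by (cases G) auto
qed (auto simp: rename_atom_involution[OF assms] fimage_involution[OF assms] assms)

lemma subtree_at_rename:
  "subtree_at (rename_gap_tree \<pi> G) p = map_option (rename_gap_tree \<pi>) (subtree_at G p)"
  by (induction G p rule: subtree_at.induct) auto

text \<open>The counterpart of \<open>renamed_part\<close> on gap trees. The position
  \<open>r\<close> of the renamed subtree is recorded because it determines on which paths a
  completing function has to be changed.\<close>

inductive renamed_at ::
  "(var \<Rightarrow> var) \<Rightarrow> position \<Rightarrow> ('f, 'r) gap_tree \<Rightarrow> ('f, 'r) gap_tree \<Rightarrow> bool" for \<pi> where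
  root: "renamed_at \<pi> [] G (rename_gap_tree \<pi> G)"
| neg: "renamed_at \<pi> r G G' \<Longrightarrow> renamed_at \<pi> (0 # r) (GNeg (Some G)) (GNeg (Some G'))"
| left: "renamed_at \<pi> r G G' \<Longrightarrow> renamed_at \<pi> (0 # r) (GConn c G H) (GConn c G' H)"
| right: "renamed_at \<pi> r H H' \<Longrightarrow> renamed_at \<pi> (Suc 0 # r) (GConn c G H) (GConn c G H')"
| quant: "renamed_at \<pi> r G G' \<Longrightarrow> \<pi> w = w \<Longrightarrow>
    renamed_at \<pi> (0 # r) (GQuant q w W G) (GQuant q w W G')"

text \<open>Reduces the equality of the two classes to one inclusion.\<close>

lemma renamed_at_sym:
  assumes "renamed_at \<pi> r G G'" and "\<And>x. \<pi> (\<pi> x) = x"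
  shows "renamed_at \<pi> r G' G"
  using assms(1)
proof (induction rule: renamed_at.induct)
  case (root G)
  then show ?case
    using renamed_at.root[of \<pi> "rename_gap_tree \<pi> G"] rename_gap_tree_involution[OF assms(2), of G]
    by simp
qed (auto intro: renamed_at.intros)

section \<open>Nodes and quantifiers before and after the renaming\<close>

definition quantifies_at :: "('f, 'r) gap_tree \<Rightarrow> position \<Rightarrow> var \<Rightarrow> bool" where
  "quantifies_at G p x \<longleftrightarrow> (\<exists>q V H. subtree_at G p = Some (GQuant q x V H))"

lemma Bound_eq_quantifies_at: "Bound T P = {x. \<exists>p\<in>P. quantifies_at (hat T) p x}"
  by (simp add: Bound_def quantifies_at_def)

lemma quantifies_at_rename:
  assumes "quantifies_at G p x"
  shows "quantifies_at (rename_gap_tree \<pi> G) p (\<pi> x)"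
  using assms by (auto simp: quantifies_at_def subtree_at_rename)

text \<open>Renaming changes labels but not the shape of the tree, so both trees have the same paths
  and completing functions can be compared path by path.\<close>

lemma renamed_at_nodes:
  assumes "renamed_at \<pi> r G G'"
  shows "nodes G' = nodes G"
proof -
  have "subtree_at G' p = None \<longleftrightarrow> subtree_at G p = None" for p
    using assms
  proof (induction arbitrary: p rule: renamed_at.induct)
    case (root G)
    then show ?case by (simp add: subtree_at_rename)
  next
    case (neg r G G')
    then show ?case by (cases "(GNeg (Some G), p)" rule: subtree_at.cases) auto
  next
    case (left r G G' c H)
    then show ?case by (cases "(GConn c G H, p)" rule: subtree_at.cases) auto
  next
    case (right r H H' c G)
    then show ?case by (cases "(GConn c G H, p)" rule: subtree_at.cases) auto
  next
    case (quant r G G' w q W)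
    then show ?case by (cases "(GQuant q w W G, p)" rule: subtree_at.cases) auto
  qed
  then show ?thesis by (simp add: nodes_def)
qed

lemma renamed_at_quantifies_below:
  assumes "renamed_at \<pi> r G G'" and "prefix r p" and "quantifies_at G p x"
  shows "quantifies_at G' p (\<pi> x)"
  using assms
proof (induction arbitrary: p rule: renamed_at.induct)
  case (root G)
  then show ?case by (simp add: quantifies_at_rename)
qed (auto simp: prefix_def quantifies_at_def)

lemma renamed_at_quantifies_above:
  assumes "renamed_at \<pi> r G G'" and "strict_prefix p r" and "quantifies_at G p x"
  shows "\<pi> x = x"
  using assms
  by (induction arbitrary: p rule: renamed_at.induct)
    (auto simp: strict_prefix_def prefix_Cons quantifies_at_def, blast+)

lemma renamed_at_quantifies_outside:
  assumes "renamed_at \<pi> r G G'" and "\<not> prefix r p" and "quantifies_at G p x"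
  shows "quantifies_at G' p x"
  using assms
proof (induction arbitrary: p rule: renamed_at.induct)
  case (neg r G G')
  then show ?case
    by (cases "(GNeg (Some G), p)" rule: subtree_at.cases) (auto simp: quantifies_at_def)
next
  case (left r G G' c H)
  then show ?case
    by (cases "(GConn c G H, p)" rule: subtree_at.cases) (auto simp: quantifies_at_def)
next
  case (right r H H' c G)
  then show ?case
    by (cases "(GConn c G H, p)" rule: subtree_at.cases) (auto simp: quantifies_at_def)
next
  case (quant r G G' w q W)
  then show ?case
    by (cases "(GQuant q w W G, p)" rule: subtree_at.cases) (auto simp: quantifies_at_def)
qed simp


subsection \<open>Renaming the values of a completing function\<close>

definition rename_below ::
  "(var \<Rightarrow> var) \<Rightarrow> position \<Rightarrow> ('f, 'r) completing \<Rightarrow> ('f, 'r) completing" where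
  "rename_below \<pi> r e P = (if \<exists>p\<in>P. prefix r p then rename_form \<pi> (e P) else e P)"

lemma rename_below_prefixes:
  "rename_below \<pi> r e (set (prefixes p)) =
    (if prefix r p then rename_form \<pi> (e (set (prefixes p))) else e (set (prefixes p)))"
proof -
  have "(\<exists>p'\<in>set (prefixes p). prefix r p') \<longleftrightarrow> prefix r p"
    by (auto intro: prefix_order.trans)
  then show ?thesis by (simp add: rename_below_def)
qed

text \<open>Filling from position \<open>p\<close> consults the completing function only at prefix
  sets of positions extending \<open>p\<close>.\<close>

lemma fill_cong:
  assumes "\<And>s. e' (set (prefixes (p @ s))) = e (set (prefixes (p @ s)))"
  shows "fill e' p G = fill e p G"
  using assms
proof (induction e p G rule: fill.induct)
  case (1 e p)
  then show ?case using "1"[of "[]"] by simp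
qed (auto split: option.splits)

lemma fill_rename:
  assumes "\<And>s. e' (set (prefixes (p @ s))) = rename_form \<pi> (e (set (prefixes (p @ s))))"
  shows "fill e' p (rename_gap_tree \<pi> G) = map_option (rename_form \<pi>) (fill e p G)"
  using assms
proof (induction e p G rule: fill.induct)
  case (1 e p)
  then show ?case using "1"[of "[]"] by simp
qed (auto simp: option.map_comp comp_def split: option.splits)

text \<open>Stated for arbitrary \<open>p\<close>, since \<open>fill\<close> carries the absolute
  position, which is why the renaming happens below \<open>p @ r\<close>. On the way down to
  \<open>r\<close>, siblings are filled as before by \<open>fill_cong\<close>; at \<open>r\<close>,
  \<open>fill_rename\<close> takes over.\<close>

lemma fill_rename_below:
  assumes "renamed_at \<pi> r G G'" and "fill e p G = Some \<phi>"
  shows "\<exists>\<phi>'. fill (rename_below \<pi> (p @ r) e) p G' = Some \<phi>' \<and> renamed_part \<pi> \<phi> \<phi>'"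
  using assms
proof (induction arbitrary: p \<phi> rule: renamed_at.induct)
  case (root G)
  have "fill (rename_below \<pi> (p @ []) e) p (rename_gap_tree \<pi> G) =
      map_option (rename_form \<pi>) (fill e p G)"
    by (rule fill_rename) (simp add: rename_below_prefixes)
  then show ?case using root by (auto intro: renamed_part.whole)
next
  case (neg r G G')
  \<comment> \<open>A filled negation stands before an atom, so the subtree \<open>G\<close> can
    only be renamed at its root. The negated atom is then a renamed part as a whole.\<close>
  then obtain a where a: "G = GAtom a" "\<phi> = NegAtom a"
    by (cases G) auto
  with neg.hyps have "G' = GAtom (rename_atom \<pi> a)"
    by (auto elim: renamed_at.cases)
  then show ?case
    using a renamed_part.whole[of \<pi> "NegAtom a"] by simp
next
  case (left r G G' c H)
  then obtain \<psi> \<chi> where "fill e (p @ [0]) G = Some \<psi>" "fill e (p @ [1]) H = Some \<chi>"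
    "\<phi> = Conn c \<psi> \<chi>"
    by (auto split: option.splits)
  moreover have "fill (rename_below \<pi> (p @ 0 # r) e) (p @ [1]) H = fill e (p @ [1]) H"
    by (rule fill_cong) (simp add: rename_below_prefixes)
  ultimately show ?case
    using left.IH[of "p @ [0]"] by (auto intro: renamed_part.left)
next
  case (right r H H' c G)
  then obtain \<psi> \<chi> where "fill e (p @ [0]) G = Some \<psi>" "fill e (p @ [1]) H = Some \<chi>"
    "\<phi> = Conn c \<psi> \<chi>"
    by (auto split: option.splits)
  moreover have "fill (rename_below \<pi> (p @ Suc 0 # r) e) (p @ [0]) G = fill e (p @ [0]) G"
    by (rule fill_cong) (simp add: rename_below_prefixes)
  ultimately show ?case
    using right.IH[of "p @ [1]"] by (auto intro: renamed_part.right)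
next
  case (quant r G G' w q W)
  then obtain \<psi> where "fill e (p @ [0]) G = Some \<psi>" "\<phi> = Quant q w W \<psi>"
    by auto
  then show ?case
    using quant.IH[of "p @ [0]"] renamed_part.quant[of \<pi> \<psi> _ w q W, OF _ quant.hyps(2)] by auto
qed

lemma paths_chain:
  assumes "P \<in> paths T" and "p \<in> P" and "p' \<in> P"
  shows "prefix p p' \<or> prefix p' p"
  using assms unfolding paths_def pred_on.maxchain_def pred_on.chain_def by blast

text \<open>On a path through \<open>r\<close>, quantifiers at or below \<open>r\<close> have their
  variables renamed, while those above bind variables fixed by \<open>\<pi>\<close>; either way
  \<open>\<pi> x\<close> is bound. Other paths keep their quantifiers. This preserves
  sententiality.\<close>

lemma Bound_renamed_at:
  assumes ren: "renamed_at \<pi> r (hat T) (hat T')" and P: "P \<in> paths T"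
  shows "(if \<exists>p\<in>P. prefix r p then \<pi> ` Bound T P else Bound T P) \<subseteq> Bound T' P"
proof (cases "\<exists>p\<in>P. prefix r p")
  case True
  then obtain p0 where p0: "p0 \<in> P" "prefix r p0" by blast
  have "\<pi> x \<in> Bound T' P" if "p \<in> P" "quantifies_at (hat T) p x" for p x
  proof (cases "prefix r p")
    case True
    then show ?thesis
      using renamed_at_quantifies_below[OF ren] that by (auto simp: Bound_eq_quantifies_at)
  next
    case False
    \<comment> \<open>If \<open>p0\<close> were a prefix of \<open>p\<close>, so would be
      \<open>r\<close>. Hence \<open>p\<close> and \<open>r\<close> are both prefixes of
      \<open>p0\<close> and therefore comparable.\<close>
    then have "strict_prefix p r"
      using paths_chain[OF P that(1) p0(1)] p0(2)
      by (metis prefix_order.less_le_not_le prefix_order.trans prefix_same_cases)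
    then have "\<pi> x = x"
      using renamed_at_quantifies_above[OF ren] that(2) by blast
    then show ?thesis
      using renamed_at_quantifies_outside[OF ren False] that by (auto simp: Bound_eq_quantifies_at)
  qed
  then show ?thesis using True by (auto simp: Bound_eq_quantifies_at)
next
  case False
  then show ?thesis
    using renamed_at_quantifies_outside[OF ren] by (auto simp: Bound_eq_quantifies_at)
qed

lemma C_subset_if_renamed_at:
  assumes inv: "\<And>x. \<pi> (\<pi> x) = x" and ren: "renamed_at \<pi> r (hat T) (hat T')"
  shows "(C \<sigma> T :: ('a, 'f, 'r) struct set set) \<subseteq> C \<sigma> T'"
proof
  fix K :: "('a, 'f, 'r) struct set"
  assume "K \<in> C \<sigma> T"
  then obtain \<phi> e where K: "K = finite_models \<sigma> \<phi>"
    and e: "completing_function \<sigma> T e" "weak T e" "sentential T e"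
    and \<phi>: "completion e T = Some \<phi>" "sentence \<sigma> \<phi>"
    unfolding C_def by blast
  let ?e = "rename_below \<pi> r e"
  note inj = inj_involution[OF inv]
  have paths: "paths T' = paths T"
    by (simp add: paths_def renamed_at_nodes[OF ren])
  have "completing_function \<sigma> T' ?e" "weak T' ?e"
    using e(1,2)
    by (auto simp: completing_function_def weak_def paths rename_below_def wf_rename_form
        regular_rename_form[OF inj] quantifier_free_rename_form)
  moreover have "sentential T' ?e"
    unfolding sentential_def paths
  proof
    fix P assume P: "P \<in> paths T"
    then have "FV (e P) \<subseteq> Bound T P"
      using e(3) by (simp add: sentential_def)
    then show "FV (?e P) \<subseteq> Bound T' P"
      using Bound_renamed_at[OF ren P]
      by (auto simp: rename_below_def FV_rename_form[OF inj] split: if_splits)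
  qed
  moreover obtain \<phi>' where \<phi>': "completion ?e T' = Some \<phi>'" "renamed_part \<pi> \<phi> \<phi>'"
    using fill_rename_below[OF ren, of e "[]" \<phi>] \<phi>(1) by (auto simp: completion_def)
  moreover have "sentence \<sigma> \<phi>'"
    using \<phi>(2) renamed_part_wf[OF \<phi>'(2)] renamed_part_FV[OF \<phi>'(2) inj] by (simp add: sentence_def)
  \<comment> \<open>The initial team consists of the empty assignment, so the domain condition holds
    vacuously.\<close>
  moreover have "K = finite_models \<sigma> \<phi>'"
    using renamed_part_sat[OF \<phi>'(2) inv, of "{Map.empty :: 'a assignment}"]
    by (simp add: K finite_models_def true_in_def)
  ultimately show "K \<in> C \<sigma> T'"
    unfolding C_def by blast
qed


section \<open>Substitution as a renaming\<close>

lemma differ_in_subtree_BV: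
  assumes "differ_in_subtree S S' T T'"
  shows "tree_BV S \<subseteq> tree_BV T" and "tree_BV S' \<subseteq> tree_BV T'"
  using assms by (induction rule: differ_in_subtree.induct) auto

lemma differ_in_subtree_no_requantification:
  assumes "differ_in_subtree S S' T T'" and "tree_no_requantification T"
  shows "tree_no_requantification S"
  using assms by (induction rule: differ_in_subtree.induct) auto

text \<open>A quantifier above the subtree that binds a moved variable would requantify a variable
  bound in \<open>S\<close> or in \<open>S'\<close>, contradicting the condition on \<open>T\<close>
  or on \<open>T'\<close> respectively.\<close>

lemma renamed_at_if_differ_in_subtree:
  assumes "differ_in_subtree S S' T T'"
    and "hat S' = rename_gap_tree \<pi> (hat S)"
    and "\<And>x. \<pi> x \<noteq> x \<Longrightarrow> x \<in> tree_BV S \<union> tree_BV S'"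
    and "tree_no_requantification T" and "tree_no_requantification T'"
  shows "\<exists>r. renamed_at \<pi> r (hat T) (hat T')"
  using assms(1,4,5)
proof (induction rule: differ_in_subtree.induct)
  case root
  then show ?case using renamed_at.root[of \<pi> "hat S"] assms(2) by auto
next
  case (quant t t' q w W)
  then have "\<pi> w = w"
    using differ_in_subtree_BV[OF quant.hyps] assms(3) by fastforce
  then show ?case using quant by (auto intro: renamed_at.quant)
qed (auto intro: renamed_at.neg renamed_at.left renamed_at.right)

lemma rename_var_eq_transpose: "x \<noteq> v \<Longrightarrow> rename_var u v x = transpose u v x"
  by (simp add: rename_var_def transpose_def)

lemma subst_trm_eq_rename:
  "v \<notin> vars_trm t \<Longrightarrow> subst_trm t u v = rename_trm (transpose u v) t"
  by (induction t) (auto simp: rename_var_eq_transpose)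

lemma subst_atom_eq_rename:
  "v \<notin> vars_atom a \<Longrightarrow> subst_atom a u v = rename_atom (transpose u v) a"
  by (cases a) (auto simp: subst_trm_eq_rename)

text \<open>No quantifier of \<open>R\<close> binds \<open>u\<close>, so all its occurrences are
  free and get replaced. The transposition does the same: it leaves quantified variables alone, as
  they differ from \<open>u\<close> and \<open>v\<close>, and there is no \<open>v\<close> to turn
  into \<open>u\<close>.\<close>

lemma hat_Subst:
  assumes "v \<notin> tree_vars R" and "u \<notin> tree_BV R"
  shows "hat (Subst R u v) = rename_gap_tree (transpose u v) (hat R)"
  using assms
proof (induction R u v rule: Subst.induct)
  case (1 a u v)
  then show ?case by (simp add: subst_atom_eq_rename)
next
  case (2 t u v)
  then show ?case by (cases t) auto
next
  case (3 c l r u v)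
  then show ?case by (cases l; cases r) auto
next
  case (4 q w W t u v)
  then have "rename_var u v |`| W = transpose u v |`| W"
    by (intro fset.map_cong) (auto simp: rename_var_def transpose_def)
  moreover have "w \<noteq> u" "w \<noteq> v" using 4 by auto
  ultimately show ?case using 4 by (cases t) auto
qed

theorem mainTheorem17:
  fixes \<sigma> :: "('f, 'r) signature"
    and T T' :: "('f, 'r) tree"
    and R :: "('f, 'r) tree option"
    and q :: quantifier
    and u v :: var
    and U :: "var fset"
  assumes "regular_tree T"
    and "regular_tree T'"
    and "differ_in_subtree (TQuant q u U R) (TQuant q v U (map_option (\<lambda>R'. Subst R' u v) R)) T T'"
    and "v \<notin> tree_vars (TQuant q u U R)"
    and "u |\<notin>| U"
  shows "(C \<sigma> T :: ('a, 'f, 'r) struct set set) = C \<sigma> T'"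
proof -
  let ?\<pi> = "transpose u v"
  have inv: "?\<pi> (?\<pi> x) = x" for x by simp
  have noreq: "tree_no_requantification T" "tree_no_requantification T'"
    using assms(1,2) by (auto simp: regular_tree_def)
  \<comment> \<open>Both roots carry the slash set \<open>U\<close>, so the transposition has to fix
    it; it does, as neither \<open>u\<close> nor \<open>v\<close> lies in \<open>U\<close>.\<close>
  have "?\<pi> |`| U = id |`| U"
    using assms(4,5) by (intro fset.map_cong) (auto simp: transpose_def)
  then have "hat (TQuant q v U (map_option (\<lambda>R'. Subst R' u v) R)) =
      rename_gap_tree ?\<pi> (hat (TQuant q u U R))"
    \<comment> \<open>Regularity of \<open>T\<close> forbids requantifying \<open>u\<close> below
      the root of the subtree, as \<open>hat_Subst\<close> requires.\<close>
    using differ_in_subtree_no_requantification[OF assms(3) noreq(1)] assms(4)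
    by (cases R) (auto simp: hat_Subst)
  \<comment> \<open>The moved variables are among \<open>u\<close> and \<open>v\<close>, which the
    two root quantifiers bind.\<close>
  moreover have "x \<in> tree_BV (TQuant q u U R) \<union>
      tree_BV (TQuant q v U (map_option (\<lambda>R'. Subst R' u v) R))" if "?\<pi> x \<noteq> x" for x
    using that by (auto simp: transpose_def split: if_splits)
  ultimately obtain r where "renamed_at ?\<pi> r (hat T) (hat T')"
    using renamed_at_if_differ_in_subtree[OF assms(3) _ _ noreq, where \<pi> = ?\<pi>] by blast
  then show ?thesis
    using C_subset_if_renamed_at[OF inv] renamed_at_sym[OF _ inv] by (intro equalityI) blast+
qed

end
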